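(* Suppose transient faults follow a Weibull distribution with scale parameter $r>0$ and shape parameter $k>1$, so that $\overline{F}(t) = e^{-(t/r)^k}$. Then the optimal rejuvenation period, i.e. the value of $T_r$ that maximizes the system reliability $$R(L,T_r) = \rho^{2\left(\frac{L}{T_r}-1\right)}\cdot\overline{F}(T_r)^{\frac{L}{T_r}},$$ is $$T_r^* = \sqrt[k]{\frac{2r^k\ln\rho}{1-k}}.$$ It is obtained by substituting $\overline{F}(t) = e^{-(t/r)^k}$ into the condition $\frac{\partial R}{\partial T_r}(L,T_r)=0$, that is, $$\frac{T_r}{\overline{F}(T_r)}\cdot\frac{d\overline{F}(T_r)}{dT_r} - \ln\overline{F}(T_r) - 2\ln\rho = 0,$$ and solving for $T_r$.
   Context: A system operates on the time interval $[0,L]$ ($L$ is its longevity). Its main processing unit is rejuvenated periodically with period $T_r$; each rejuvenation involves two task migrations between the main and a backup processing unit, and each migration succeeds with constant probability $\rho$ (with $\rho=1$ if both processing units are located on the same computer). The Weibull distribution of transient faults has failure rate $\lambda(t) = k t^{k-1}/r^k$, which increases with time $t$ when $k>1$, and cumulative distribution function $F(t) = 1-e^{-(t/r)^k}$; $\overline{F} = 1-F$. The system reliability is taken to be its worst-case value, the function $R(L,T_r)$ displayed in the claim.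
   Formalization: If ρ=1, the formula gives T_r*=0, where R is undefined, and no positive T_r maximizes R; so the maximizer claim is made for 0<ρ<1, and for ρ=1 it is stated that R<1 for all T_r>0 and R→1 as T_r→0+. ρ=0 is excluded since ln ρ is undefined. *)

theory Defs
  imports "HOL-Probability.Probability"
begin

text \<open>The law of the fault time is a probability measure on the reals whose distribution function
  is the Weibull one. Values at negative times need not be prescribed: they vanish because the value
  at 0 does.\<close>

definition weibull_distribution :: "real \<Rightarrow> real \<Rightarrow> real measure \<Rightarrow> bool" where
  "weibull_distribution r k D \<longleftrightarrow>
     real_distribution D \<and> (\<forall>t\<ge>0. cdf D t = 1 - exp (- ((t / r) powr k)))"

definition survival :: "real measure \<Rightarrow> real \<Rightarrow> real" where
  "survival D t = 1 - cdf D t"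

text \<open>The number \<open>L / T\<close> of periods is a real number here, hence the real powers. The formula is
  meaningful for \<open>T > 0\<close> only.\<close>

definition reliability :: "real \<Rightarrow> (real \<Rightarrow> real) \<Rightarrow> real \<Rightarrow> real \<Rightarrow> real" where
  "reliability \<rho> G L T = \<rho> powr (2 * (L / T - 1)) * G T powr (L / T)"

text \<open>The exponent \<open>k\<close> is real, so the \<open>k\<close>-th root is a power with exponent \<open>1 / k\<close>; the radicand is
  nonnegative for \<open>0 < \<rho> \<le> 1\<close> and \<open>k > 1\<close>.\<close>

definition optimal_period :: "real \<Rightarrow> real \<Rightarrow> real \<Rightarrow> real" where
  "optimal_period \<rho> r k = (2 * r powr k * ln \<rho> / (1 - k)) powr (1 / k)"

end

(*
  For a Weibull survival function G the derivative of the reliability is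
  R(T) * (L / T^2) * C(T), where C(T) is the left-hand side of the stationarity condition, and
  C(T) = (1 - k) * (T/r)^k - 2 ln rho.  For k > 1 this is strictly decreasing, positive before the
  optimal period and negative after it; hence R increases up to that point and decreases afterwards.
*)
theory Submission
  imports Defs
begin

lemma weibull_survival_eq:
  assumes "weibull_distribution r k D" "t \<ge> 0"
  shows "survival D t = exp (- ((t / r) powr k))"
  using assms by (simp add: weibull_distribution_def survival_def)

lemma weibull_survival_has_derivative:
  assumes D: "weibull_distribution r k D" and "r > 0" "T > 0"
  shows "(survival D has_real_derivative
           - (exp (- ((T / r) powr k)) * (k * (T / r) powr k / T))) (at T)"
\<comment> \<open>The closed form of \<open>survival D\<close> is known only at nonnegative times,
  so it is differentiated as a function in its own right and the result carried over on the open
  half-line of positive times.\<close>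
proof (rule has_field_derivative_transform_within_open)
  show "((\<lambda>t. exp (- ((t / r) powr k))) has_real_derivative
           - (exp (- ((T / r) powr k)) * (k * (T / r) powr k / T))) (at T)"
    using \<open>r > 0\<close> \<open>T > 0\<close>
    by (auto intro!: derivative_eq_intros simp: powr_diff)
  show "exp (- ((t / r) powr k)) = survival D t" if "t \<in> {0<..}" for t
    using weibull_survival_eq[OF D, of t] that by simp
qed (use \<open>T > 0\<close> in auto)

lemma weibull_condition_eq:
  assumes D: "weibull_distribution r k D" and "r > 0" "T > 0"
  shows "T / survival D T * deriv (survival D) T - ln (survival D T) - 2 * ln \<rho>
           = (1 - k) * (T / r) powr k - 2 * ln \<rho>"
  using weibull_survival_eq[OF D, of T] DERIV_imp_deriv[OF weibull_survival_has_derivative[OF assms]] \<open>T > 0\<close>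
  by (simp add: field_simps)

text \<open>Both real powers have positive bases, so they merge into one exponential. The later
  differentiation, positivity and limit arguments all start from this form.\<close>

lemma weibull_reliability_eq:
  assumes D: "weibull_distribution r k D" and "T > 0" "\<rho> > 0"
  shows "reliability \<rho> (survival D) L T = exp (2 * (L / T - 1) * ln \<rho> - L * (T / r) powr k / T)"
  using weibull_survival_eq[OF D, of T] \<open>T > 0\<close> \<open>\<rho> > 0\<close>
  by (simp add: reliability_def powr_def exp_add[symmetric])

lemma weibull_reliability_has_derivative:
  assumes D: "weibull_distribution r k D" and "r > 0" "T > 0" "\<rho> > 0"
  shows "(reliability \<rho> (survival D) L has_real_derivative
           reliability \<rho> (survival D) L T * (L / T\<^sup>2) * ((1 - k) * (T / r) powr k - 2 * ln \<rho>)) (at T)"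
proof (rule has_field_derivative_transform_within_open)
  show "((\<lambda>t. exp (2 * (L / t - 1) * ln \<rho> - L * (t / r) powr k / t)) has_real_derivative
           reliability \<rho> (survival D) L T * (L / T\<^sup>2) * ((1 - k) * (T / r) powr k - 2 * ln \<rho>)) (at T)"
    unfolding weibull_reliability_eq[OF D \<open>T > 0\<close> \<open>\<rho> > 0\<close>] using \<open>r > 0\<close> \<open>T > 0\<close>
    by (auto intro!: derivative_eq_intros simp: powr_diff power2_eq_square) (simp add: field_simps)
  show "exp (2 * (L / t - 1) * ln \<rho> - L * (t / r) powr k / t) = reliability \<rho> (survival D) L t"
    if "t \<in> {0<..}" for t
    using weibull_reliability_eq[OF D, of t] that \<open>\<rho> > 0\<close> by simp
qed (use \<open>T > 0\<close> in auto)

lemma weibull_reliability_pos: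
  assumes "weibull_distribution r k D" "T > 0" "\<rho> > 0"
  shows "reliability \<rho> (survival D) L T > 0"
  by (simp add: weibull_reliability_eq[OF assms])

lemma optimal_period_pos:
  assumes "r > 0" "k > 1" "0 < \<rho>" "\<rho> < 1"
  shows "optimal_period \<rho> r k > 0"
  using assms by (simp add: optimal_period_def divide_simps mult_less_0_iff)

text \<open>A positive constant times a difference of \<open>k\<close>-th powers: the zero and the
  sign of the condition can then be read off from the monotonicity of \<open>powr k\<close>
  alone.\<close>

lemma condition_eq_optimal_period:
  assumes "r > 0" "k > 1" "0 < \<rho>" "\<rho> \<le> 1" "T > 0"
  shows "(1 - k) * (T / r) powr k - 2 * ln \<rho>
           = (k - 1) / r powr k * (optimal_period \<rho> r k powr k - T powr k)"
proof -
  \<comment> \<open>Since \<open>ln \<rho> \<le> 0\<close> and \<open>1 - k < 0\<close>, the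
    radicand is nonnegative, so \<open>powr k\<close> undoes the root.\<close>
  have "2 * r powr k * ln \<rho> / (1 - k) \<ge> 0"
    using assms by (simp add: divide_nonpos_neg mult_nonneg_nonpos)
  then have "optimal_period \<rho> r k powr k = 2 * r powr k * ln \<rho> / (1 - k)"
    using \<open>k > 1\<close> by (simp add: optimal_period_def powr_powr del: abs_divide)
  then show ?thesis
    using \<open>r > 0\<close> \<open>k > 1\<close> \<open>T > 0\<close> by (simp add: powr_divide divide_simps) (simp add: algebra_simps)
qed

text \<open>The boundary case \<open>\<rho> = 1\<close> is included: the optimal period is then 0
  and the condition is negative at every \<open>T > 0\<close>. By trichotomy the two equivalences
  also locate the zero.\<close>

lemma condition_sign:
  assumes "r > 0" "k > 1" "0 < \<rho>" "\<rho> \<le> 1" "T > 0"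
  shows "(1 - k) * (T / r) powr k - 2 * ln \<rho> > 0 \<longleftrightarrow> T < optimal_period \<rho> r k"
    and "(1 - k) * (T / r) powr k - 2 * ln \<rho> < 0 \<longleftrightarrow> optimal_period \<rho> r k < T"
proof -
  have "optimal_period \<rho> r k \<ge> 0"
    by (simp add: optimal_period_def)
  \<comment> \<open>The value 0 must be allowed here, because the optimal period vanishes when
    \<open>\<rho> = 1\<close>.\<close>
  moreover have "a powr k < b powr k \<longleftrightarrow> a < b" if "a \<ge> 0" "b \<ge> 0" for a b
    using that \<open>k > 1\<close> powr_less_mono2[of k a b] powr_mono2[of k b a] by fastforce
  ultimately have less: "T powr k < optimal_period \<rho> r k powr k \<longleftrightarrow> T < optimal_period \<rho> r k"
    and greater: "optimal_period \<rho> r k powr k < T powr k \<longleftrightarrow> optimal_period \<rho> r k < T"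
    using \<open>T > 0\<close> by simp_all
  define c where "c = (k - 1) / r powr k"
  have "c > 0"
    using assms by (simp add: c_def)
  then show "(1 - k) * (T / r) powr k - 2 * ln \<rho> > 0 \<longleftrightarrow> T < optimal_period \<rho> r k"
    and "(1 - k) * (T / r) powr k - 2 * ln \<rho> < 0 \<longleftrightarrow> optimal_period \<rho> r k < T"
    unfolding condition_eq_optimal_period[OF assms] less[symmetric] greater[symmetric] c_def[symmetric]
    by (simp_all add: zero_less_mult_iff mult_less_0_iff)
qed

text \<open>A strict comparison with every other positive period gives maximality and uniqueness of
  the maximizer at once.\<close>

lemma weibull_reliability_less_optimal:
  assumes D: "weibull_distribution r k D"
    and rk: "r > 0" "k > 1" and "L > 0" and \<rho>: "0 < \<rho>" "\<rho> < 1" and "T > 0" "T \<noteq> optimal_period \<rho> r k"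
  shows "reliability \<rho> (survival D) L T < reliability \<rho> (survival D) L (optimal_period \<rho> r k)"
proof -
  let ?R = "reliability \<rho> (survival D) L" and ?T = "optimal_period \<rho> r k"
  let ?R' = "\<lambda>t. ?R t * (L / t\<^sup>2) * ((1 - k) * (t / r) powr k - 2 * ln \<rho>)"
  have pos: "?T > 0"
    using rk \<rho> by (rule optimal_period_pos)
  have deriv: "(?R has_real_derivative ?R' t) (at t)" if "t > 0" for t
    using weibull_reliability_has_derivative[OF D rk(1) that \<rho>(1)] .
  have cont: "continuous_on {a..b} ?R" if "a > 0" for a b
  proof (rule DERIV_atLeastAtMost_imp_continuous_on)
    fix t assume "a \<le> t" "t \<le> b"
    with \<open>a > 0\<close> deriv[of t] show "\<exists>y. (?R has_real_derivative y) (at t)"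
      by auto
  qed
  have factor: "?R t * (L / t\<^sup>2) > 0" if "t > 0" for t
    using weibull_reliability_pos[OF D that \<rho>(1)] \<open>L > 0\<close> that by simp
  note sign = condition_sign[OF rk \<rho>(1) less_imp_le[OF \<rho>(2)]]
  consider "T < ?T" | "?T < T"
    using assms by linarith
  then show ?thesis
  proof cases
    case 1
    show ?thesis
    \<comment> \<open>The derivative vanishes at \<open>?T\<close> itself, so its sign is used only
      strictly between the endpoints, together with continuity on the closed interval.\<close>
    proof (rule DERIV_pos_imp_increasing_open[OF 1])
      fix t assume t: "T < t" "t < ?T"
      with \<open>T > 0\<close> have "t > 0"
        by simp
      moreover from this t have "?R' t > 0"
        using sign(1)[of t] by (intro mult_pos_pos[OF factor]) auto
      ultimately show "\<exists>y. (?R has_real_derivative y) (at t) \<and> y > 0"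
        using deriv by blast
    qed (use cont \<open>T > 0\<close> in auto)
  next
    case 2
    show ?thesis
    proof (rule DERIV_neg_imp_decreasing_open[OF 2])
      fix t assume t: "?T < t" "t < T"
      with pos have "t > 0"
        by simp
      moreover from this t have "?R' t < 0"
        using sign(2)[of t] by (intro mult_pos_neg[OF factor]) auto
      ultimately show "\<exists>y. (?R has_real_derivative y) (at t) \<and> y < 0"
        using deriv by blast
    qed (use cont pos in auto)
  qed
qed

text \<open>With \<open>\<rho> = 1\<close> the migration factor disappears and the reliability at
  \<open>t > 0\<close> is \<open>exp (- (L / r powr k * t powr (k - 1)))\<close>. The exponent tends
  to 0 because \<open>k > 1\<close>.\<close>

lemma weibull_reliability_tendsto_one:
  assumes D: "weibull_distribution r k D" and "r > 0" "k > 1"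
  shows "(reliability 1 (survival D) L \<longlongrightarrow> 1) (at_right 0)"
proof (rule Lim_transform_eventually)
  \<comment> \<open>The base of the power tends to 0, where the limit rule asks for an eventually
    nonnegative base and a positive exponent.\<close>
  have "\<forall>\<^sub>F t in at_right (0::real). 0 \<le> t"
    by (rule eventually_mono[OF eventually_at_right_less]) simp
  then have "((\<lambda>t. t powr (k - 1)) \<longlongrightarrow> 0 powr (k - 1)) (at_right (0::real))"
    using \<open>k > 1\<close> by (intro tendsto_powr2 tendsto_ident_at tendsto_const) auto
  then have "((\<lambda>t. exp (- (L / r powr k * t powr (k - 1)))) \<longlongrightarrow> exp (- (L / r powr k * 0 powr (k - 1))))
               (at_right (0::real))"
    by (intro tendsto_exp tendsto_minus tendsto_mult_left)
  then show "((\<lambda>t. exp (- (L / r powr k * t powr (k - 1)))) \<longlongrightarrow> 1) (at_right (0::real))"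
    by simp
  show "\<forall>\<^sub>F t in at_right 0. exp (- (L / r powr k * t powr (k - 1))) = reliability 1 (survival D) L t"
    using eventually_at_right_less[of 0]
  proof eventually_elim
    case (elim t)
    then show ?case
      using \<open>r > 0\<close> weibull_reliability_eq[OF D, of t 1 L] by (simp add: powr_divide powr_diff)
  qed
qed

text \<open>Differentiability is asserted alongside the equations because \<open>deriv\<close> is
  informative only where a derivative exists. For \<open>\<rho> = 1\<close> the formula yields 0,
  outside the domain \<open>T > 0\<close>: the supremum 1 is approached there but not attained, so
  optimality becomes a statement about a limit.\<close>

theorem mainTheorem4:
  fixes D :: "real measure" and r k \<rho> L :: real
  assumes "r > 0" and "k > 1" and "L > 0" and "0 < \<rho>" and "\<rho> \<le> 1"
    and "weibull_distribution r k D"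
  shows
    "(\<forall>T>0. survival D T = exp (- ((T / r) powr k))) \<and>
     (\<forall>T>0. survival D field_differentiable (at T) \<and>
            reliability \<rho> (survival D) L field_differentiable (at T) \<and>
            (deriv (reliability \<rho> (survival D) L) T = 0 \<longleftrightarrow>
               T / survival D T * deriv (survival D) T - ln (survival D T) - 2 * ln \<rho> = 0) \<and>
            (T / survival D T * deriv (survival D) T - ln (survival D T) - 2 * ln \<rho> = 0 \<longleftrightarrow>
               T = optimal_period \<rho> r k)) \<and>
     (\<rho> < 1 \<longrightarrow>
        (\<forall>T. is_arg_max (reliability \<rho> (survival D) L) (\<lambda>T. T > 0) T \<longleftrightarrow>
             T = optimal_period \<rho> r k)) \<and>
     (\<rho> = 1 \<longrightarrow>
        optimal_period \<rho> r k = 0 \<and>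
        (\<forall>T>0. reliability \<rho> (survival D) L T < 1) \<and>
        (reliability \<rho> (survival D) L \<longlongrightarrow> 1) (at_right (optimal_period \<rho> r k)))"
proof (intro conjI allI impI)
  note D = \<open>weibull_distribution r k D\<close> and r = \<open>r > 0\<close> and \<rho> = \<open>0 < \<rho>\<close>
  let ?R = "reliability \<rho> (survival D) L"
  show "survival D T = exp (- ((T / r) powr k))" if "T > 0" for T
    using weibull_survival_eq[OF D] that by simp
  show "survival D field_differentiable (at T)" if "T > 0" for T
    using weibull_survival_has_derivative[OF D r that] by (auto simp: field_differentiable_def)
  show "?R field_differentiable (at T)" if "T > 0" for T
    using weibull_reliability_has_derivative[OF D r that \<rho>] by (auto simp: field_differentiable_def)
  \<comment> \<open>The factor \<open>?R T * (L / T\<^sup>2)\<close> of the derivative is positive,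
    so only the condition can vanish.\<close>
  show "deriv ?R T = 0 \<longleftrightarrow>
          T / survival D T * deriv (survival D) T - ln (survival D T) - 2 * ln \<rho> = 0" if "T > 0" for T
    using DERIV_imp_deriv[OF weibull_reliability_has_derivative[OF D r that \<rho>, of L]]
      weibull_reliability_pos[OF D that \<rho>, of L] \<open>L > 0\<close> that
    unfolding weibull_condition_eq[OF D r that] by simp
  show "T / survival D T * deriv (survival D) T - ln (survival D T) - 2 * ln \<rho> = 0 \<longleftrightarrow>
          T = optimal_period \<rho> r k" if "T > 0" for T
    unfolding weibull_condition_eq[OF D r that]
    using condition_sign[OF r \<open>k > 1\<close> \<rho> \<open>\<rho> \<le> 1\<close> that] by linarith
  show "is_arg_max ?R (\<lambda>T. T > 0) T \<longleftrightarrow> T = optimal_period \<rho> r k" if "\<rho> < 1" for T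
    using weibull_reliability_less_optimal[OF D r \<open>k > 1\<close> \<open>L > 0\<close> \<rho> that]
      optimal_period_pos[OF r \<open>k > 1\<close> \<rho> that]
    unfolding is_arg_max_def by (metis less_asym)
  show *: "optimal_period \<rho> r k = 0" if "\<rho> = 1"
    using that by (simp add: optimal_period_def)
  show "?R T < 1" if "\<rho> = 1" "T > 0" for T
    using that r \<open>L > 0\<close> weibull_reliability_eq[OF D \<open>T > 0\<close> \<rho>, of L] by simp
  show "(?R \<longlongrightarrow> 1) (at_right (optimal_period \<rho> r k))" if "\<rho> = 1"
    using weibull_reliability_tendsto_one[OF D r \<open>k > 1\<close>] *[OF that] that by simp
qed

end
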